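(* The irreducible complex reflection groups are precisely the collineation preserving normal reflection subgroups of the maximal irreducible complex reflection groups. That is, a group $H\subset U(\mathbb{C}^d)$ is a finite irreducible complex reflection group if and only if there is a finite irreducible complex reflection group $M\subset U(\mathbb{C}^d)$ which is maximal, such that $H$ is a normal reflection subgroup of $M$ with the same collineation group as $M$.
   Context: A reflection on $\mathbb{C}^d$ is an invertible linear map $g$ with $\mathrm{rank}(I-g)=1$; a complex reflection group is a finite group generated by reflections, taken to be unitary. A reflection subgroup is a subgroup generated by reflections. The maximal reflection group for a complex reflection group $G$ is the group generated by all reflections of the form $\lambda g$ with $\lambda\in\mathbb{C}^*$, $g\in G$; a reflection group is maximal if it equals its maximal reflection group. The collineation group of a matrix group is the group factored by its scalar matrices; two matrix groups have the same collineation group if they consist of the same matrices up to nonzero scalar multiples. A subgroup of $G$ is collineation preserving if it has the same collineation group as $G$.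
   Formalization: The formal theorem assumes d ≥ 2; for d = 1 every scalar other than 0 and 1 is a reflection, so the maximal reflection group is all of C^*, no finite maximal group exists, and the claim fails, e.g. for H = {1, −1}. *)

theory Defs
  imports "HOL-Analysis.Analysis" "HOL-Algebra.Generated_Groups"
begin

definition GL :: "(complex^'n^'n) monoid" where
  "GL = \<lparr>carrier = {A. invertible A}, monoid.mult = (**), one = mat 1\<rparr>"

lemma group_GL: "group (GL :: (complex^'n^'n) monoid)"
proof (rule groupI)
  fix A :: "complex^'n^'n" assume "A \<in> carrier GL"
  then obtain B where "A ** B = mat 1" "B ** A = mat 1"
    by (auto simp: GL_def invertible_def)
  then show "\<exists>B\<in>carrier GL. B \<otimes>\<^bsub>GL\<^esub> A = \<one>\<^bsub>GL\<^esub>"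
    by (auto simp: GL_def invertible_def)
qed (auto simp: GL_def invertible_mult matrix_mul_assoc invertible_def [of "mat 1"])

definition unitary_mat :: "complex^'n^'n \<Rightarrow> bool" where
  "unitary_mat A \<longleftrightarrow> map_matrix cnj (transpose A) ** A = mat 1"

definition reflection :: "complex^'n^'n \<Rightarrow> bool" where
  "reflection g \<longleftrightarrow> invertible g \<and> rank (mat 1 - g) = 1"

text \<open>The empty set of reflections is allowed and generates the trivial group.\<close>

definition reflection_generated :: "(complex^'n^'n) set \<Rightarrow> bool" where
  "reflection_generated G \<longleftrightarrow> (\<exists>S. (\<forall>g\<in>S. reflection g) \<and> G = generate GL S)"

definition complex_reflection_group :: "(complex^'n^'n) set \<Rightarrow> bool" where
  "complex_reflection_group G \<longleftrightarrow>
     reflection_generated G \<and> finite G \<and> (\<forall>g\<in>G. unitary_mat g)"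

definition reflection_subgroup :: "(complex^'n^'n) set \<Rightarrow> (complex^'n^'n) set \<Rightarrow> bool" where
  "reflection_subgroup H G \<longleftrightarrow> subgroup H (GL\<lparr>carrier := G\<rparr>) \<and> reflection_generated H"

definition irreducible_mats :: "(complex^'n^'n) set \<Rightarrow> bool" where
  "irreducible_mats G \<longleftrightarrow>
     (\<forall>W. vec.subspace W \<and> (\<forall>g\<in>G. \<forall>w\<in>W. g *v w \<in> W) \<longrightarrow> W = {0} \<or> W = UNIV)"

text \<open>Here \<open>mat c ** g\<close> is the scalar multiple \<open>c g\<close> of the matrix \<open>g\<close>. In dimension 1
  every scalar other than 0 and 1 is a reflection, so there this group is infinite for every nonempty
  \<open>G\<close>, and no finite reflection group is maximal.\<close>

definition maximal_reflection_group :: "(complex^'n^'n) set \<Rightarrow> (complex^'n^'n) set" where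
  "maximal_reflection_group G =
     generate GL {mat c ** g | c g. c \<noteq> 0 \<and> g \<in> G \<and> reflection (mat c ** g)}"

definition maximal_reflection :: "(complex^'n^'n) set \<Rightarrow> bool" where
  "maximal_reflection G \<longleftrightarrow> maximal_reflection_group G = G"

definition same_collineation_group :: "(complex^'n^'n) set \<Rightarrow> (complex^'n^'n) set \<Rightarrow> bool" where
  "same_collineation_group G H \<longleftrightarrow>
     (\<forall>g\<in>G. \<exists>h\<in>H. \<exists>c. c \<noteq> 0 \<and> g = mat c ** h) \<and>
     (\<forall>h\<in>H. \<exists>g\<in>G. \<exists>c. c \<noteq> 0 \<and> h = mat c ** g)"

end

theory Submission
  imports Defs "HOL-Algebra.Multiplicative_Group"
begin

text \<open>
  Given \<open>H\<close>, take \<open>M\<close> to be its maximal reflection group. As \<open>d \<ge> 2\<close>, a reflection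
  \<open>\<lambda> h\<close> with \<open>h \<in> H\<close> fixes some nonzero vector \<open>v\<close>. Applying \<open>(\<lambda> h)^N\<close> to \<open>v\<close>, where
  \<open>N\<close> is the order of \<open>H\<close>, gives \<open>\<lambda>^N = 1\<close>. Hence \<open>M\<close> lies inside the finite unitary group
  of all \<open>c h\<close> with \<open>c^N = 1\<close> and \<open>h \<in> H\<close>. Conjugation by \<open>c h\<close> is conjugation by \<open>h\<close>, so \<open>H\<close>
  is normal in \<open>M\<close>. Conversely, irreducibility only depends on the matrices up to
  nonzero scalars.
\<close>

section \<open>Scalar multiples of matrices\<close>

lemma GL_simps [simp]:
  "carrier (GL :: (complex^'n^'n) monoid) = {A. invertible A}"
  "monoid.mult (GL :: (complex^'n^'n) monoid) = (**)"
  "one (GL :: (complex^'n^'n) monoid) = mat 1"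
  by (simp_all add: GL_def)

lemma mat_mult_eq:
  fixes A :: "'a::comm_ring_1^'n^'m"
  shows "mat c ** A = (\<chi> i j. c * A$i$j)"
  by (simp add: vec_eq_iff matrix_matrix_mult_def mat_def mult_delta_left)

lemma mat_mult_mult_mat:
  fixes A :: "'a::comm_ring_1^'n^'m" and B :: "'a^'k^'n"
  shows "(mat c ** A) ** (mat k ** B) = mat (c * k) ** (A ** B)"
  unfolding mat_mult_eq
  by (simp add: vec_eq_iff matrix_matrix_mult_def sum_distrib_left algebra_simps)

lemma mat_mult_mat:
  fixes A :: "'a::comm_ring_1^'n^'m"
  shows "mat c ** (mat k ** A) = mat (c * k) ** A"
  unfolding mat_mult_eq by (simp add: vec_eq_iff algebra_simps)

lemma mat_mult_vec:
  fixes A :: "'a::comm_ring_1^'n^'m"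
  shows "(mat c ** A) *v v = c *s (A *v v)"
  unfolding mat_mult_eq
  by (simp add: vec_eq_iff matrix_vector_mult_def sum_distrib_left algebra_simps)

lemma invertible_mat:
  fixes c :: "'a::field"
  assumes "c \<noteq> 0"
  shows "invertible (mat c :: 'a^'n^'n)"
proof -
  have "mat c ** mat (inverse c) = (mat 1 :: 'a^'n^'n)" "mat (inverse c) ** mat c = (mat 1 :: 'a^'n^'n)"
    using mat_mult_mat [of c "inverse c" "mat 1 :: 'a^'n^'n"]
      mat_mult_mat [of "inverse c" c "mat 1 :: 'a^'n^'n"] assms by simp_all
  then show ?thesis
    unfolding invertible_def by blast
qed

text \<open>Taking the adjoint turns the scalar \<open>c\<close> into \<open>cnj c\<close>, and
  \<open>cnj c * c\<close> is the squared norm of \<open>c\<close>.\<close>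

lemma unitary_mat_mult_mat:
  fixes h :: "complex^'n^'n"
  assumes "unitary_mat h" "norm c = 1"
  shows "unitary_mat (mat c ** h)"
proof -
  have "cnj c * c = 1"
    using assms(2) by (simp add: complex_norm_square [symmetric] mult.commute)
  moreover have "map_matrix cnj (transpose (mat c ** h)) = mat (cnj c) ** map_matrix cnj (transpose h)"
    unfolding mat_mult_eq by (simp add: vec_eq_iff map_matrix_def transpose_def)
  ultimately show ?thesis
    using assms(1) by (simp add: unitary_mat_def mat_mult_mult_mat)
qed

section \<open>Scalars that turn group elements into reflections\<close>

text \<open>In dimension at least 2 the rank 1 of \<open>mat 1 - g\<close> is not full, so this
  matrix has a nontrivial kernel, which consists of the fixed vectors of \<open>g\<close>.\<close>

lemma reflection_fixes_nonzero_vector: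
  fixes g :: "complex^'n^'n"
  assumes "reflection g" "CARD('n) \<ge> 2"
  obtains v where "v \<noteq> 0" "g *v v = v"
proof -
  have "\<not> (\<exists>B. B ** (mat 1 - g) = mat 1)"
  proof
    assume "\<exists>B. B ** (mat 1 - g) = mat 1"
    then have "vec.span (rows (mat 1 - g)) = UNIV"
      using matrix_left_invertible_span_rows_gen by blast
    then have "rank (mat 1 - g) = CARD('n)"
      unfolding row_rank_def_gen by (metis vec.dim_span vec_dim_card)
    with assms show False by (simp add: reflection_def)
  qed
  then obtain v where "v \<noteq> 0" "(mat 1 - g) *v v = 0"
    using matrix_left_invertible_ker by blast
  then show ?thesis
    using that by (simp add: matrix_vector_mult_diff_rdistrib)
qed

text \<open>The power is taken in the group with carrier \<open>H\<close>, to match the fact that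
  the order of a finite group annihilates each element.\<close>

lemma nat_pow_mult_eigenvector:
  fixes h :: "complex^'n^'n"
  assumes "h *v v = k *s v"
  shows "(h [^]\<^bsub>GL\<lparr>carrier := H\<rparr>\<^esub> (n::nat)) *v v = k ^ n *s v"
proof (induction n)
  case (Suc n)
  then show ?case
    using assms by (simp add: matrix_vector_mul_assoc [symmetric] vec.scale mult.commute)
qed simp

text \<open>A vector fixed by \<open>mat c ** h\<close> is an eigenvector of \<open>h\<close> with
  eigenvalue \<open>inverse c\<close>, and \<open>h\<close> to the power \<open>card H\<close> is
  the identity.\<close>

lemma reflection_multiple_root_of_unity:
  fixes H :: "(complex^'n^'n) set"
  assumes "subgroup H GL" "CARD('n) \<ge> 2" "h \<in> H" "reflection (mat c ** h)"
  shows "c ^ card H = 1"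
proof -
  interpret K: group "GL\<lparr>carrier := H\<rparr>"
    using group.subgroup_imp_group [OF group_GL assms(1)] .
  obtain v where v: "v \<noteq> 0" "c *s (h *v v) = v"
    using reflection_fixes_nonzero_vector [OF assms(4,2)] by (auto simp: mat_mult_vec)
  then have c: "c \<noteq> 0" by auto
  have "h *v v = inverse c *s (c *s (h *v v))"
    using c by simp
  also have "\<dots> = inverse c *s v"
    by (simp only: v(2))
  finally have "(h [^]\<^bsub>GL\<lparr>carrier := H\<rparr>\<^esub> card H) *v v = inverse c ^ card H *s v"
    by (rule nat_pow_mult_eigenvector)
  moreover have "h [^]\<^bsub>GL\<lparr>carrier := H\<rparr>\<^esub> card H = mat 1"
    using K.pow_order_eq_1 [of h] assms(3) by (simp add: order_def)
  \<comment> \<open>Writing \<open>v\<close> as \<open>1 *s v\<close> allows the nonzero vector to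
    be cancelled.\<close>
  ultimately have "inverse c ^ card H *s v = 1 *s v"
    by simp
  with v(1) have "inverse c ^ card H = 1"
    by (simp only: vec.scale_cancel_right) simp
  then show ?thesis
    by (simp add: power_inverse)
qed

text \<open>Scalars commute with matrices, so closure reduces to closure of the \<open>N\<close>-th
  roots of unity and of \<open>H\<close> separately.\<close>

lemma subgroup_root_multiples:
  fixes H :: "(complex^'n^'n) set"
  assumes H: "subgroup H GL" and N: "N > 0"
  shows "subgroup {mat c ** h | c h. c ^ N = 1 \<and> h \<in> H} GL" (is "subgroup ?K GL")
proof
  interpret G: group "GL :: (complex^'n^'n) monoid" by (rule group_GL)
  have inv: "invertible h" if "h \<in> H" for h
    using subgroup.mem_carrier [OF H that] by simp
  show sub: "?K \<subseteq> carrier GL"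
    using inv N by (auto intro!: invertible_mult invertible_mat simp: zero_power)
  show "\<one>\<^bsub>GL\<^esub> \<in> ?K"
    using subgroup.one_closed [OF H] by (auto intro!: exI [of _ "1::complex"] exI [of _ "mat 1 :: complex^'n^'n"])
  fix x assume x: "x \<in> ?K"
  then obtain c h where ch: "x = mat c ** h" "c ^ N = 1" "h \<in> H" by blast
  \<comment> \<open>Since \<open>0 ^ 0 = 1\<close>, positivity of \<open>N\<close> is what excludes
    the scalar 0.\<close>
  then have c: "c \<noteq> 0" using N by (auto simp: zero_power)
  have i: "inv\<^bsub>GL\<^esub> h \<in> H" "inv\<^bsub>GL\<^esub> h ** h = mat 1"
    using subgroup.m_inv_closed [OF H ch(3)] G.l_inv [of h] inv [OF ch(3)] by auto
  \<comment> \<open>The candidate for the inverse of \<open>x\<close>: its scalar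
    \<open>inverse c\<close> is again an \<open>N\<close>-th root of unity.\<close>
  have k: "mat (inverse c) ** inv\<^bsub>GL\<^esub> h \<in> ?K"
    using ch(2) i(1) by (auto simp: power_inverse intro!: exI [of _ "inverse c"])
  have "inv\<^bsub>GL\<^esub> x = mat (inverse c) ** inv\<^bsub>GL\<^esub> h"
    using k x sub by (intro G.inv_equality) (auto simp: ch(1) mat_mult_mult_mat i(2) c)
  with k show "inv\<^bsub>GL\<^esub> x \<in> ?K" by simp
  fix y assume "y \<in> ?K"
  then obtain d k where dk: "y = mat d ** k" "d ^ N = 1" "k \<in> H" by blast
  show "x \<otimes>\<^bsub>GL\<^esub> y \<in> ?K"
    using ch dk subgroup.m_closed [OF H ch(3) dk(3)]
    by (auto simp: mat_mult_mult_mat power_mult_distrib intro!: exI [of _ "c * d"])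
qed

section \<open>Transfer of irreducibility\<close>

lemma irreducible_mats_mono:
  assumes "irreducible_mats G" "G \<subseteq> G'"
  shows "irreducible_mats G'"
  using assms unfolding irreducible_mats_def by blast

text \<open>Subspaces are closed under scaling, so one that is invariant under \<open>H\<close> is
  also invariant under all scalar multiples of members of \<open>H\<close>, hence under
  \<open>M\<close>.\<close>

lemma irreducible_mats_same_collineation:
  fixes H M :: "(complex^'n^'n) set"
  assumes "irreducible_mats M" "same_collineation_group H M"
  shows "irreducible_mats H"
  unfolding irreducible_mats_def
proof (intro allI impI)
  fix W :: "(complex^'n) set"
  assume W: "vec.subspace W \<and> (\<forall>g\<in>H. \<forall>w\<in>W. g *v w \<in> W)"
  have "g *v w \<in> W" if "g \<in> M" "w \<in> W" for g w
  proof -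
    obtain h c where "h \<in> H" "g = mat c ** h"
      using assms(2) \<open>g \<in> M\<close> unfolding same_collineation_group_def by blast
    then show ?thesis
      using W \<open>w \<in> W\<close> by (simp add: mat_mult_vec vec.subspace_scale)
  qed
  then show "W = {0} \<or> W = UNIV"
    using assms(1) W unfolding irreducible_mats_def by blast
qed

section \<open>The maximal reflection group\<close>

lemma reflection_multiples_subset_carrier:
  "{mat c ** g | c g. c \<noteq> 0 \<and> g \<in> G \<and> reflection (mat c ** g)} \<subseteq> carrier GL"
  by (auto simp: reflection_def)

lemma subgroup_maximal_reflection_group: "subgroup (maximal_reflection_group G) GL"
  unfolding maximal_reflection_group_def
  by (rule group.generate_is_subgroup [OF group_GL reflection_multiples_subset_carrier])

lemma reflection_generated_maximal_reflection_group:
  "reflection_generated (maximal_reflection_group G)"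
  unfolding reflection_generated_def maximal_reflection_group_def
  by (rule exI, rule conjI [OF _ refl]) blast

lemma reflection_in_maximal_reflection_group:
  assumes "g \<in> G" "reflection (mat c ** g)" "c \<noteq> 0"
  shows "mat c ** g \<in> maximal_reflection_group G"
  using assms unfolding maximal_reflection_group_def by (intro generate.incl) blast

text \<open>It suffices to place the generating reflections, and each is its own multiple by the
  scalar 1.\<close>

lemma subset_maximal_reflection_group:
  assumes "reflection_generated H"
  shows "H \<subseteq> maximal_reflection_group H"
proof -
  obtain S where S: "\<forall>g\<in>S. reflection g" "H = generate GL S"
    using assms unfolding reflection_generated_def by blast
  have "S \<subseteq> maximal_reflection_group H"
  proof
    fix s assume "s \<in> S"
    then have "s \<in> H" "reflection s"
      using S by (auto intro: generate.incl)
    then show "s \<in> maximal_reflection_group H"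
      using reflection_in_maximal_reflection_group [of s H 1] by simp
  qed
  then show ?thesis
    unfolding S(2)
    by (rule group.generate_subgroup_incl [OF group_GL _ subgroup_maximal_reflection_group])
qed

text \<open>Every generator is a root-of-unity multiple of a member of \<open>H\<close>, and these
  multiples form a group. This bound yields finiteness and unitarity later.\<close>

lemma maximal_reflection_group_subset:
  fixes H :: "(complex^'n^'n) set"
  assumes H: "subgroup H GL" "finite H" and d: "CARD('n) \<ge> 2"
  shows "maximal_reflection_group H \<subseteq> {mat c ** h | c h. c ^ card H = 1 \<and> h \<in> H}"
proof -
  have "card H > 0"
    using subgroup.one_closed [OF H(1)] H(2) by (auto simp: card_gt_0_iff)
  then show ?thesis
    unfolding maximal_reflection_group_def
    using reflection_multiple_root_of_unity [OF H(1) d]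
    by (intro group.generate_subgroup_incl [OF group_GL] subgroup_root_multiples H(1)) blast+
qed

text \<open>Scaling twice is scaling once: a reflection that is a multiple of a member of
  \<open>?M\<close> is also a multiple of a member of \<open>H\<close>, hence already a generator of
  \<open>?M\<close>.\<close>

lemma maximal_reflection_maximal_reflection_group:
  fixes H :: "(complex^'n^'n) set"
  assumes "\<And>m. m \<in> maximal_reflection_group H \<Longrightarrow> \<exists>c h. c \<noteq> 0 \<and> h \<in> H \<and> m = mat c ** h"
  shows "maximal_reflection (maximal_reflection_group H)"
proof -
  let ?M = "maximal_reflection_group H"
  have "{mat c ** g | c g. c \<noteq> 0 \<and> g \<in> ?M \<and> reflection (mat c ** g)} \<subseteq> ?M"
  proof clarify
    fix c g assume c: "(c::complex) \<noteq> 0" and g: "g \<in> ?M" and r: "reflection (mat c ** g)"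
    obtain k h where "k \<noteq> 0" "h \<in> H" "g = mat k ** h"
      using assms [OF g] by blast
    then show "mat c ** g \<in> ?M"
      using c r reflection_in_maximal_reflection_group [of h H "c * k"]
      by (simp add: mat_mult_mat)
  qed
  then have "maximal_reflection_group ?M \<subseteq> ?M"
    unfolding maximal_reflection_group_def [of ?M]
    by (rule group.generate_subgroup_incl [OF group_GL _ subgroup_maximal_reflection_group])
  \<comment> \<open>The reverse inclusion holds for any group generated by reflections.\<close>
  then show ?thesis
    unfolding maximal_reflection_def
    using subset_maximal_reflection_group [OF reflection_generated_maximal_reflection_group]
    by blast
qed

section \<open>Normality and equality of collineation groups\<close>

text \<open>In a conjugate by \<open>mat c ** k\<close> the scalar cancels, leaving the conjugate by
  \<open>k\<close>, which lies in \<open>H\<close>.\<close>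

lemma normal_scalar_multiples:
  fixes H M :: "(complex^'n^'n) set"
  assumes H: "subgroup H GL" and M: "subgroup M GL" and HM: "H \<subseteq> M"
    and scal: "\<And>m. m \<in> M \<Longrightarrow> \<exists>c h. c \<noteq> 0 \<and> h \<in> H \<and> m = mat c ** h"
  shows "H \<lhd> GL\<lparr>carrier := M\<rparr>"
proof (rule group.normal_invI)
  interpret G: group "GL :: (complex^'n^'n) monoid" by (rule group_GL)
  show "group (GL\<lparr>carrier := M\<rparr>)" by (rule G.subgroup_imp_group [OF M])
  show "subgroup H (GL\<lparr>carrier := M\<rparr>)" by (rule G.subgroup_incl [OF H M HM])
  fix x h assume "x \<in> carrier (GL\<lparr>carrier := M\<rparr>)" and h: "h \<in> H"
  then have x: "x \<in> M" by simp
  then obtain c k where ck: "c \<noteq> 0" "k \<in> H" "x = mat c ** k" using scal by blast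
  have inv: "invertible k" "invertible h" "invertible x"
    using subgroup.mem_carrier [OF H] subgroup.mem_carrier [OF M] ck(2) h x by auto
  have conj: "k ** h ** inv\<^bsub>GL\<^esub> k \<in> H"
    using subgroup.m_closed [OF H] subgroup.m_inv_closed [OF H] ck(2) h by fastforce
  \<comment> \<open>Moving \<open>x\<close> to the right end avoids computing its inverse in terms
    of \<open>c\<close> and \<open>k\<close>.\<close>
  have comm: "x ** h = (k ** h ** inv\<^bsub>GL\<^esub> k) ** x"
  proof -
    have "(k ** h ** inv\<^bsub>GL\<^esub> k) ** x = mat c ** (k ** h ** (inv\<^bsub>GL\<^esub> k ** k))"
      \<comment> \<open>The conjugate is read as a multiple by the scalar 1, so that
        \<open>c\<close> can be pulled to the front.\<close>
      using mat_mult_mult_mat [of 1 "k ** h ** inv\<^bsub>GL\<^esub> k" c k]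
      by (simp add: ck(3) matrix_mul_assoc)
    also have "inv\<^bsub>GL\<^esub> k ** k = mat 1"
      using G.l_inv [of k] inv by simp
    finally show ?thesis
      by (simp add: ck(3) matrix_mul_assoc)
  qed
  have "x ** inv\<^bsub>GL\<^esub> x = mat 1"
    using G.r_inv [of x] inv by simp
  then have "x ** h ** inv\<^bsub>GL\<^esub> x = k ** h ** inv\<^bsub>GL\<^esub> k"
    unfolding comm by (simp add: matrix_mul_assoc [symmetric])
  then show "x \<otimes>\<^bsub>GL\<lparr>carrier := M\<rparr>\<^esub> h \<otimes>\<^bsub>GL\<lparr>carrier := M\<rparr>\<^esub> inv\<^bsub>GL\<lparr>carrier := M\<rparr>\<^esub> x \<in> H"
    using conj G.m_inv_consistent [OF M x] by simp
qed

lemma same_collineation_group_if: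
  fixes H M :: "(complex^'n^'n) set"
  assumes "H \<subseteq> M"
    and "\<And>m. m \<in> M \<Longrightarrow> \<exists>c h. c \<noteq> 0 \<and> h \<in> H \<and> m = mat c ** h"
  shows "same_collineation_group H M"
  unfolding same_collineation_group_def
proof (intro conjI ballI)
  fix g assume "g \<in> H"
  then show "\<exists>h\<in>M. \<exists>c. c \<noteq> 0 \<and> g = mat c ** h"
    using assms(1) by (intro bexI [of _ g] exI [of _ 1]) auto
qed (use assms(2) in blast)

theorem theorem3p1:
  fixes H :: "(complex^'n^'n) set"
  assumes "CARD('n) \<ge> 2"
    and "subgroup H GL" and "\<forall>h\<in>H. unitary_mat h"
  shows "complex_reflection_group H \<and> irreducible_mats H \<longleftrightarrow>
    (\<exists>M :: (complex^'n^'n) set.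
       complex_reflection_group M \<and> irreducible_mats M \<and> maximal_reflection M \<and>
       reflection_subgroup H M \<and> H \<lhd> GL\<lparr>carrier := M\<rparr> \<and>
       same_collineation_group H M)"
proof
  assume "complex_reflection_group H \<and> irreducible_mats H"
  then have gen: "reflection_generated H" and fin: "finite H" and irr: "irreducible_mats H"
    by (auto simp: complex_reflection_group_def)
  let ?M = "maximal_reflection_group H"
  let ?K = "{mat c ** h | c h. c ^ card H = 1 \<and> h \<in> H}"
  have N: "card H > 0"
    using subgroup.one_closed [OF assms(2)] fin by (auto simp: card_gt_0_iff)
  have HM: "H \<subseteq> ?M"
    by (rule subset_maximal_reflection_group [OF gen])
  have MK: "?M \<subseteq> ?K"
    by (rule maximal_reflection_group_subset [OF assms(2) fin assms(1)])
  have scal: "\<exists>c h. c \<noteq> 0 \<and> h \<in> H \<and> m = mat c ** h" if m: "m \<in> ?M" for m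
  proof -
    obtain c h where "c ^ card H = 1" "h \<in> H" "m = mat c ** h"
      using MK m by blast
    moreover from this N have "c \<noteq> 0" by (auto simp: zero_power)
    ultimately show ?thesis by blast
  qed
  \<comment> \<open>\<open>?K\<close> is contained in the image of a product of two finite sets: the
    roots of unity of positive order \<open>card H\<close>, and \<open>H\<close>.\<close>
  have "finite ((\<lambda>(c, h). mat c ** h) ` ({c. c ^ card H = 1} \<times> H))"
    using fin N by (intro finite_imageI finite_cartesian_product finite_nth_roots)
  then have "finite ?K"
    by (rule rev_finite_subset) auto
  then have "finite ?M"
    using MK finite_subset by blast
  moreover have "unitary_mat m" if m: "m \<in> ?M" for m
  proof -
    obtain c h where ch: "c ^ card H = 1" "h \<in> H" "m = mat c ** h"
      using MK m by blast
    \<comment> \<open>Roots of unity have modulus 1, so scaling by them preserves unitarity.\<close>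
    then have "norm c = 1"
      using N power_eq_1_iff [of c "card H"] by auto
    with ch assms(3) show ?thesis
      by (simp add: unitary_mat_mult_mat)
  qed
  ultimately have "complex_reflection_group ?M"
    by (simp add: complex_reflection_group_def reflection_generated_maximal_reflection_group)
  moreover have "irreducible_mats ?M"
    by (rule irreducible_mats_mono [OF irr HM])
  moreover have "maximal_reflection ?M"
    using scal by (rule maximal_reflection_maximal_reflection_group)
  moreover have "reflection_subgroup H ?M"
    unfolding reflection_subgroup_def
    using group.subgroup_incl [OF group_GL assms(2) subgroup_maximal_reflection_group HM] gen
    by blast
  moreover have "H \<lhd> GL\<lparr>carrier := ?M\<rparr>"
    using assms(2) subgroup_maximal_reflection_group HM scal by (rule normal_scalar_multiples)
  moreover have "same_collineation_group H ?M"
    using HM scal by (rule same_collineation_group_if)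
  ultimately show "\<exists>M. complex_reflection_group M \<and> irreducible_mats M \<and> maximal_reflection M \<and>
       reflection_subgroup H M \<and> H \<lhd> GL\<lparr>carrier := M\<rparr> \<and> same_collineation_group H M"
    by blast
next
  assume "\<exists>M. complex_reflection_group M \<and> irreducible_mats M \<and> maximal_reflection M \<and>
       reflection_subgroup H M \<and> H \<lhd> GL\<lparr>carrier := M\<rparr> \<and> same_collineation_group H M"
  then obtain M where M: "complex_reflection_group M" "irreducible_mats M"
      "reflection_subgroup H M" "same_collineation_group H M"
    by blast
  \<comment> \<open>Finiteness of \<open>H\<close> is inherited from \<open>M\<close> through this
    inclusion; generation by reflections is part of being a reflection subgroup.\<close>
  have "H \<subseteq> M"
    using M(3) subgroup.subset unfolding reflection_subgroup_def by fastforce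
  then have "complex_reflection_group H"
    using M(1,3) assms(3) finite_subset
    unfolding complex_reflection_group_def reflection_subgroup_def by blast
  then show "complex_reflection_group H \<and> irreducible_mats H"
    using irreducible_mats_same_collineation [OF M(2,4)] by blast
qed

end
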